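(* Let $G=(V,E)$ be an $n$-vertex hypergraph with a hyperedge-cost function $c\colon E\to\mathbb{R}_+$ and $t$ vertex-weight functions $w_1,\dots,w_t\colon V\to\mathbb{R}_+$. (1) If $G$ has rank $r$, then the number of node-budgeted multiobjective min-cuts of $G$ is $O(r\,2^{r}\,n^{t+2})$. (2) For any fixed budget-vector $b\in\mathbb{R}^t_+$, the number of node-budgeted $b$-multiobjective min-cuts of $G$ is $O(n^2)$ (with no assumption on the rank).
   Context: The rank of a hypergraph is the size of its largest hyperedge. For $U\subseteq V$, $\delta(U)$ is the set of hyperedges intersecting both $U$ and $V\setminus U$; $c(F)=\sum_{e\in F}c(e)$ and $w_i(U)=\sum_{u\in U}w_i(u)$. For $b\in\mathbb{R}^t_+$, a set $U\subseteq V$ is feasible if $w_i(U)\le b_i$ for all $i\in[t]$. A set $F\subseteq E$ is a node-budgeted $b$-multiobjective min-cut if $F=\delta(X)$ for some feasible $X$ with $\emptyset\neq X\subsetneq V$, and $c(F)$ is minimum among all such sets $\delta(X)$. $F$ is a node-budgeted multiobjective min-cut if it is a node-budgeted $b$-multiobjective min-cut for some $b\in\mathbb{R}^t_+$. Cuts are counted as distinct sets of hyperedges.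
   Formalization: Hyperedge costs are taken strictly positive (with all-zero costs on the complete graph there are 2^(n-1)-1 distinct min-cuts, so both bounds fail), and part (1) assumes at least one hyperedge so that the rank is defined. *)

theory Defs
  imports Complex_Main
begin

definition hypergraph :: "'v set \<Rightarrow> 'v set set \<Rightarrow> bool" where
  "hypergraph V E \<longleftrightarrow> finite V \<and> (\<forall>e\<in>E. e \<noteq> {} \<and> e \<subseteq> V)"

(* Only meaningful for a nonempty set of hyperedges: an edgeless hypergraph has no rank. *)
definition rank :: "'v set set \<Rightarrow> nat" where
  "rank E = Max (card ` E)"

definition cut :: "'v set \<Rightarrow> 'v set set \<Rightarrow> 'v set \<Rightarrow> 'v set set" where
  "cut V E U = {e \<in> E. e \<inter> U \<noteq> {} \<and> e \<inter> (V - U) \<noteq> {}}"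

(* Weight functions and budgets are indexed by {1..t}; values at other indices are irrelevant. *)
definition feasible ::
    "'v set \<Rightarrow> nat \<Rightarrow> (nat \<Rightarrow> 'v \<Rightarrow> real) \<Rightarrow> (nat \<Rightarrow> real) \<Rightarrow> 'v set \<Rightarrow> bool" where
  "feasible V t w b U \<longleftrightarrow> U \<subseteq> V \<and> (\<forall>i\<in>{1..t}. (\<Sum>u\<in>U. w i u) \<le> b i)"

definition budget_min_cut ::
    "'v set \<Rightarrow> 'v set set \<Rightarrow> ('v set \<Rightarrow> real) \<Rightarrow> nat \<Rightarrow> (nat \<Rightarrow> 'v \<Rightarrow> real) \<Rightarrow> (nat \<Rightarrow> real)
      \<Rightarrow> 'v set set \<Rightarrow> bool" where
  "budget_min_cut V E c t w b F \<longleftrightarrow>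
     (\<exists>X. feasible V t w b X \<and> X \<noteq> {} \<and> X \<subset> V \<and> F = cut V E X) \<and>
     (\<forall>Y. feasible V t w b Y \<and> Y \<noteq> {} \<and> Y \<subset> V \<longrightarrow> (\<Sum>e\<in>F. c e) \<le> (\<Sum>e\<in>cut V E Y. c e))"

definition multiobjective_min_cut ::
    "'v set \<Rightarrow> 'v set set \<Rightarrow> ('v set \<Rightarrow> real) \<Rightarrow> nat \<Rightarrow> (nat \<Rightarrow> 'v \<Rightarrow> real) \<Rightarrow> 'v set set \<Rightarrow> bool" where
  "multiobjective_min_cut V E c t w F \<longleftrightarrow>
     (\<exists>b. (\<forall>i\<in>{1..t}. 0 \<le> b i) \<and> budget_min_cut V E c t w b F)"

(* Costs are strictly positive: if zero costs were allowed, the complete graph with all costs 0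
   would have exponentially many minimum cuts, counted as sets of hyperedges.
   Vertex weights (and budgets) may be 0. *)
definition cost_weight_functions ::
    "'v set \<Rightarrow> 'v set set \<Rightarrow> ('v set \<Rightarrow> real) \<Rightarrow> nat \<Rightarrow> (nat \<Rightarrow> 'v \<Rightarrow> real) \<Rightarrow> bool" where
  "cost_weight_functions V E c t w \<longleftrightarrow>
     (\<forall>e\<in>E. 0 < c e) \<and> (\<forall>i\<in>{1..t}. \<forall>v\<in>V. 0 \<le> w i v)"

end

theory Submission
  imports Defs "HOL-Library.Disjoint_Sets" "HOL-Library.FuncSet"
begin

text \<open>
  This is a derandomised form of Karger's contraction argument. A contracted hypergraph is a
  partition \<open>P\<close> of the vertices; a block is light if it is feasible, so that a feasible set
  that is a union of blocks uses only light blocks, and a light block is itself a competitor for the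
  minimum. Hence a minimum cut \<open>F\<close> costs at most the average degree of the \<open>m\<close> light blocks,
  \<open>m * c(F) \<le> (\<Sum>e. c e * a e)\<close>, where \<open>a e\<close> counts the light blocks met by \<open>e\<close>. Contracting an
  edge outside \<open>F\<close> keeps \<open>F\<close>, and averaging over the contracted edge with weights \<open>c e\<close> drives
  an induction on the size of \<open>P\<close>.

  For a fixed budget the count is \<open>m * (m - 1)\<close>, apart from the cut around the union of all light
  blocks. If the budget varies, the contraction order does not depend on it. The cut \<open>F\<close> survives
  until at most \<open>r\<close> blocks are light for its own budget, and is then one of \<open>2 ^ r\<close> guesses, with
  probability of order \<open>1 / (2 ^ r * n\<^sup>2)\<close>. For each partition into \<open>k\<close> blocks only
  \<open>r * k ^ (t - 1)\<close> sets of at most \<open>r\<close> blocks are the light blocks of some budget, and these numbers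
  sum to at most \<open>r * n ^ t\<close> along the contraction.
\<close>

section \<open>Contraction of partitions and its effect on light blocks\<close>

definition touched :: "'v set set \<Rightarrow> 'v set \<Rightarrow> 'v set set" where
  "touched P e = {B \<in> P. B \<inter> e \<noteq> {}}"

definition contract :: "'v set set \<Rightarrow> 'v set \<Rightarrow> 'v set set" where
  "contract P e = insert (\<Union>(touched P e)) (P - touched P e)"

definition crossing :: "'v set set \<Rightarrow> 'v set set \<Rightarrow> 'v set set" where
  "crossing E P = {e \<in> E. 2 \<le> card (touched P e)}"

text \<open>\<open>I\<close> is an abstract feasibility predicate, so the same facts serve a fixed
  budget and budgets that vary with the cut.\<close>

definition light :: "('v set \<Rightarrow> bool) \<Rightarrow> 'v set set \<Rightarrow> 'v set set" where
  "light I P = {B \<in> P. I B}"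

definition saturated :: "'v set set \<Rightarrow> 'v set \<Rightarrow> bool" where
  "saturated P X \<longleftrightarrow> (\<forall>B\<in>P. B \<subseteq> X \<or> B \<inter> X = {})"

definition hereditary :: "('v set \<Rightarrow> bool) \<Rightarrow> bool" where
  "hereditary I \<longleftrightarrow> (\<forall>A B. I B \<and> A \<subseteq> B \<longrightarrow> I A)"

lemma finite_light: "finite P \<Longrightarrow> finite (light I P)"
  by (simp add: light_def)

lemma touched_subset: "touched P e \<subseteq> P"
  by (auto simp: touched_def)

text \<open>If \<open>e\<close> met no block, \<open>contract\<close> would insert the empty set;
  hence the second hypothesis.\<close>

lemma partition_on_contract:
  assumes "partition_on V P" "touched P e \<noteq> {}"
  shows "partition_on V (contract P e)"
proof (rule partition_onI)
  show "\<Union>(contract P e) = V"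
    using partition_onD1[OF assms(1)] touched_subset[of P e] by (auto simp: contract_def)
  show "{} \<notin> contract P e"
    using partition_onD3[OF assms(1)] assms(2) by (auto simp: contract_def touched_def)
  show "disjnt p q" if "p \<in> contract P e" "q \<in> contract P e" "p \<noteq> q" for p q
  proof -
    have *: "B \<inter> \<Union>(touched P e) = {}" if "B \<in> P - touched P e" for B
      using that partition_onD2[OF assms(1)] by (fastforce simp: disjoint_def touched_def)
    have "p \<inter> q = {}" if "p \<in> P" "q \<in> P"
      using that \<open>p \<noteq> q\<close> partition_onD2[OF assms(1)] by (simp add: disjoint_def)
    then show ?thesis
      using that * unfolding contract_def disjnt_def by (metis DiffE inf_commute insertE)
  qed
qed

lemma Union_touched_notin:
  assumes "partition_on V P" "touched P e \<noteq> {}"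
  shows "\<Union>(touched P e) \<notin> P - touched P e"
proof
  assume U: "\<Union>(touched P e) \<in> P - touched P e"
  obtain B x where "B \<in> touched P e" "x \<in> B" "x \<in> e"
    using assms(2) by (auto simp: touched_def)
  then have "x \<in> \<Union>(touched P e) \<inter> e" by blast
  then show False using U by (auto simp: touched_def)
qed

lemma card_contract:
  assumes "partition_on V P" "finite P" "2 \<le> card (touched P e)"
  shows "card (contract P e) < card P"
proof -
  have ne: "touched P e \<noteq> {}" using assms(3) by auto
  have fin: "finite (touched P e)" using assms(2) touched_subset finite_subset by metis
  have "card (contract P e) \<le> Suc (card (P - touched P e))"
    unfolding contract_def by (rule card_insert_le_m1) auto
  moreover have "card (P - touched P e) = card P - card (touched P e)"
    using fin touched_subset by (rule card_Diff_subset)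
  moreover have "card (touched P e) \<le> card P"
    using assms(2) touched_subset by (rule card_mono)
  ultimately show ?thesis using assms(3) by linarith
qed

text \<open>An uncut hyperedge lies on one side of \<open>X\<close>. By saturation the blocks it
  meets lie on that side too, so merging them does not split \<open>X\<close>.\<close>

lemma saturated_contract:
  assumes "saturated P X" "e \<subseteq> V" "e \<in> E" "e \<notin> cut V E X"
  shows "saturated (contract P e) X"
proof -
  have "e \<subseteq> X \<or> e \<inter> X = {}" using assms by (auto simp: cut_def)
  then show ?thesis
  proof
    assume "e \<subseteq> X"
    then have "B \<subseteq> X" if "B \<in> touched P e" for B
      using assms(1) that unfolding saturated_def touched_def by blast
    then show ?thesis using assms(1) by (auto simp: saturated_def contract_def)
  next
    assume "e \<inter> X = {}"
    then have "B \<inter> X = {}" if "B \<in> touched P e" for B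
      using assms(1) that unfolding saturated_def touched_def by blast
    then show ?thesis using assms(1) by (auto simp: saturated_def contract_def)
  qed
qed

lemma saturated_Union:
  assumes "partition_on V P" "saturated P X" "X \<subseteq> V"
  shows "X = \<Union>{B \<in> P. B \<subseteq> X}"
proof
  show "X \<subseteq> \<Union>{B \<in> P. B \<subseteq> X}"
  proof
    fix x assume x: "x \<in> X"
    then obtain B where "B \<in> P" "x \<in> B" using assms(3) partition_onD1[OF assms(1)] by auto
    then show "x \<in> \<Union>{B \<in> P. B \<subseteq> X}" using assms(2) x by (auto simp: saturated_def)
  qed
qed auto

lemma light_contract:
  assumes "partition_on V P" "touched P e \<noteq> {}"
  shows "light I (contract P e) =
    (light I P - touched P e) \<union> (if I (\<Union>(touched P e)) then {\<Union>(touched P e)} else {})"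
  by (auto simp: light_def contract_def)

lemma card_light_contract:
  assumes "partition_on V P" "finite P" "touched P e \<noteq> {}"
  shows "card (light I (contract P e)) =
    card (light I P) - card (light I P \<inter> touched P e) + (if I (\<Union>(touched P e)) then 1 else 0)"
proof -
  have "\<Union>(touched P e) \<notin> light I P - touched P e"
    using Union_touched_notin[OF assms(1,3)] by (auto simp: light_def)
  then show ?thesis
    unfolding light_contract[OF assms(1,3)] using finite_light[OF assms(2), of I]
    by (simp add: card_Diff_subset_Int)
qed

text \<open>By heredity a light merged block has only light parts. A contraction therefore either
  fuses light blocks into one light block or destroys every light block it touches.\<close>

lemma touched_light:
  assumes "hereditary I" "I (\<Union>(touched P e))"
  shows "touched P e \<subseteq> light I P"
  using assms unfolding hereditary_def light_def touched_def by blast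

text \<open>Distinct blocks are disjoint, so choosing a point of \<open>e\<close> in each touched
  block is injective.\<close>

lemma card_touched_le:
  assumes "partition_on V P" "finite e"
  shows "card (touched P e) \<le> card e"
proof -
  obtain f where f: "\<forall>B\<in>touched P e. f B \<in> B \<inter> e"
    using bchoice[of "touched P e" "\<lambda>B x. x \<in> B \<inter> e"] by (auto simp: touched_def)
  have "inj_on f (touched P e)"
  proof (rule inj_onI)
    fix A B assume "A \<in> touched P e" "B \<in> touched P e" "f A = f B"
    then have "A \<in> P" "B \<in> P" "f A \<in> A \<inter> B" using f by (auto simp: touched_def)
    then show "A = B" using partition_onD2[OF assms(1)] by (auto simp: disjoint_def)
  qed
  then show ?thesis using f assms(2) by (intro card_inj_on_le[of f]) auto
qed

section \<open>Feasibility under budgets and threshold sets\<close>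

lemma hereditary_feasible:
  assumes "finite V" "\<And>i v. i \<in> {1..t} \<Longrightarrow> v \<in> V \<Longrightarrow> 0 \<le> w i v"
  shows "hereditary (feasible V t w b)"
  unfolding hereditary_def
proof (intro allI impI)
  fix A B assume AB: "feasible V t w b B \<and> A \<subseteq> B"
  have "sum (w i) A \<le> b i" if i: "i \<in> {1..t}" for i
  proof -
    have "sum (w i) A \<le> sum (w i) B"
      using AB assms i finite_subset[OF _ assms(1)]
      by (intro sum_mono2) (auto simp: feasible_def)
    also have "\<dots> \<le> b i" using AB i by (simp add: feasible_def)
    finally show ?thesis .
  qed
  then show "feasible V t w b A" using AB by (auto simp: feasible_def)
qed

text \<open>Each of the first \<open>t - 1\<close> thresholds can be lowered to the largest block
  weight not exceeding it, so \<open>card P\<close> values per coordinate suffice. The last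
  threshold is not discretised: it runs through a chain, where the size, between 1 and
  \<open>r\<close>, identifies the set. This replaces one factor \<open>card P\<close> by
  \<open>r\<close>.\<close>

lemma card_threshold_sets_le:
  fixes W :: "nat \<Rightarrow> 'a \<Rightarrow> real"
  assumes "finite P" "1 \<le> t"
  shows "card {S. S \<noteq> {} \<and> card S \<le> r \<and> (\<exists>b. S = {B \<in> P. \<forall>i\<in>{1..t}. W i B \<le> b i})}
    \<le> r * card P ^ (t - 1)" (is "card ?T \<le> _")
proof -
  let ?Q = "\<lambda>f \<beta>. {B \<in> P. (\<forall>i\<in>{1..<t}. W i B \<le> W i (f i)) \<and> W t B \<le> (\<beta> :: real)}"
  have "\<exists>q. fst q \<in> {1..<t} \<rightarrow>\<^sub>E P \<and> S = ?Q (fst q) (snd q)" if S: "S \<in> ?T" for S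
  proof -
    obtain b where b: "S = {B \<in> P. \<forall>i\<in>{1..t}. W i B \<le> b i}" and "S \<noteq> {}" using S by auto
    then obtain A where A: "A \<in> P" "\<forall>i\<in>{1..t}. W i A \<le> b i" by auto
    have "\<forall>i\<in>{1..<t}. \<exists>C. C \<in> P \<and> (\<forall>B\<in>P. W i B \<le> b i \<longleftrightarrow> W i B \<le> W i C)"
    proof
      fix i assume i: "i \<in> {1..<t}"
      \<comment> \<open>\<open>A\<close> lies below every threshold, so \<open>?D\<close> is
        nonempty and its maximal weight is attained.\<close>
      let ?D = "{B \<in> P. W i B \<le> b i}"
      have D: "finite ?D" "A \<in> ?D" using assms(1) A i by auto
      then have "Max (W i ` ?D) \<in> W i ` ?D" by (intro Max_in) auto
      then obtain C where C: "C \<in> ?D" "Max (W i ` ?D) = W i C" by auto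
      then have "W i B \<le> W i C" if "B \<in> ?D" for B
        using D(1) that Max_ge[of "W i ` ?D" "W i B"] by auto
      then show "\<exists>C. C \<in> P \<and> (\<forall>B\<in>P. W i B \<le> b i \<longleftrightarrow> W i B \<le> W i C)"
        using C(1) by (intro exI[of _ C]) force
    qed
    then obtain f where f: "\<forall>i\<in>{1..<t}. f i \<in> P \<and> (\<forall>B\<in>P. W i B \<le> b i \<longleftrightarrow> W i B \<le> W i (f i))"
      by (rule bchoice[THEN exE])
    have "{1..t} = insert t {1..<t}" using assms(2) by auto
    then have "S = {B \<in> P. (\<forall>i\<in>{1..<t}. W i B \<le> W i (restrict f {1..<t} i)) \<and> W t B \<le> b t}"
      using f unfolding b by auto
    moreover have "restrict f {1..<t} \<in> {1..<t} \<rightarrow>\<^sub>E P" using f by auto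
    ultimately show ?thesis by (intro exI[of _ "(restrict f {1..<t}, b t)"]) simp
  qed
  then have "\<forall>S\<in>?T. \<exists>q. fst q \<in> {1..<t} \<rightarrow>\<^sub>E P \<and> S = ?Q (fst q) (snd q)" by (rule ballI)
  then have "\<exists>q. \<forall>S\<in>?T. fst (q S) \<in> {1..<t} \<rightarrow>\<^sub>E P \<and> S = ?Q (fst (q S)) (snd (q S))"
    by (rule bchoice)
  then obtain q where q: "\<forall>S\<in>?T. fst (q S) \<in> {1..<t} \<rightarrow>\<^sub>E P \<and> S = ?Q (fst (q S)) (snd (q S))"
    by (rule exE)
  have finT: "finite S" if "S \<in> ?T" for S using that assms(1) by auto
  \<comment> \<open>With the first \<open>t - 1\<close> thresholds fixed, the sets form a chain, so the size determines the set.\<close>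
  have "inj_on (\<lambda>S. (card S, fst (q S))) ?T"
  proof (rule inj_onI)
    fix S S' assume SS': "S \<in> ?T" "S' \<in> ?T" "(card S, fst (q S)) = (card S', fst (q S'))"
    then have eq: "card S = card S'" "fst (q S) = fst (q S')" by auto
    define f \<beta> \<beta>' where "f = fst (q S)" "\<beta> = snd (q S)" "\<beta>' = snd (q S')"
    note f_def = this
    have S: "S = ?Q f \<beta>"
      unfolding f_def using bspec[OF q SS'(1)] by (rule conjunct2)
    have S': "S' = ?Q f \<beta>'"
      unfolding f_def eq(2) using bspec[OF q SS'(2)] by (rule conjunct2)
    have "?Q f \<beta> \<subseteq> ?Q f \<beta>' \<or> ?Q f \<beta>' \<subseteq> ?Q f \<beta>" by (cases "\<beta> \<le> \<beta>'") auto
    then have "S \<subseteq> S' \<or> S' \<subseteq> S" by (simp only: S[symmetric] S'[symmetric])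
    then show "S = S'"
      using card_subset_eq[OF finT[OF SS'(2)] _ eq(1)]
        card_subset_eq[OF finT[OF SS'(1)] _ eq(1)[symmetric]] by blast
  qed
  moreover have "(\<lambda>S. (card S, fst (q S))) ` ?T \<subseteq> {1..r} \<times> ({1..<t} \<rightarrow>\<^sub>E P)"
  proof (rule image_subsetI)
    fix S assume S: "S \<in> ?T"
    then have "1 \<le> card S" using finT[OF S] by (simp add: Suc_le_eq card_gt_0_iff)
    then show "(card S, fst (q S)) \<in> {1..r} \<times> ({1..<t} \<rightarrow>\<^sub>E P)" using bspec[OF q S] finT[OF S] S by auto
  qed
  ultimately have "card ?T \<le> card ({1..r} \<times> ({1..<t} \<rightarrow>\<^sub>E P))"
    using assms(1) by (intro card_inj_on_le) (auto intro: finite_PiE)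
  also have "\<dots> = r * card P ^ (t - 1)" by (simp add: card_cartesian_product card_PiE)
  finally show ?thesis .
qed

section \<open>Arithmetic of the survival bound\<close>

text \<open>
  Reciprocal of the probability with which a minimum cut survives contraction from \<open>m\<close> light blocks
  down to at most \<open>r\<close> and is then guessed as a subset of the remaining light blocks.
\<close>

definition guess_bound :: "nat \<Rightarrow> nat \<Rightarrow> real" where
  "guess_bound r m = (if m \<le> r then 2 ^ m else 2 * 2 ^ r * real (m - r) * real (m - r + 1))"

lemma guess_bound_pos: "0 < guess_bound r m"
  by (simp add: guess_bound_def)

lemma guess_bound_le:
  assumes "1 \<le> r" "1 \<le> n" "m \<le> n"
  shows "guess_bound r m \<le> 2 * 2 ^ r * real n ^ 2"
proof (cases "m \<le> r")
  case True
  have "1 \<le> real n ^ 2" using assms(2) by (intro one_le_power) simp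
  then have "(2::real) ^ m * 1 \<le> 2 ^ r * (2 * real n ^ 2)"
    using True by (intro mult_mono power_increasing) auto
  then show ?thesis using True by (simp add: guess_bound_def)
next
  case False
  \<comment> \<open>The added 1 is absorbed by \<open>1 \<le> r\<close>.\<close>
  have "real (m - r) * real (m - r + 1) \<le> real n * real n"
    using False assms by (intro mult_mono) auto
  then show ?thesis using False by (simp add: guess_bound_def power2_eq_square)
qed

text \<open>Recurrence for a contraction that loses at least \<open>a - 1\<close> of
  \<open>m\<close> light blocks. If \<open>k\<close> stays above \<open>r\<close>, it is a cubic
  inequality; otherwise the factor \<open>2 ^ (r - k)\<close> by which the number of guesses shrinks
  makes up for the long jump.\<close>

lemma guess_bound_step:
  assumes "r < m" "2 \<le> a" "k + a \<le> m + 1"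
  shows "(real (m - r) + real a) * guess_bound r k \<le> real (m - r) * guess_bound r m"
proof -
  define M where "M = real (m - r)"
  have M1: "1 \<le> M" using assms(1) by (simp add: M_def)
  have gm: "guess_bound r m = 2 * 2 ^ r * M * (M + 1)"
    using assms(1) by (simp add: guess_bound_def M_def)
  show ?thesis
  proof (cases "k \<le> r")
    case True
    define d where "d = r - k"
    have r: "r = k + d" using True by (simp add: d_def)
    have a: "real a \<le> M + 1 + d"
      using assms(1,3) r by (simp add: M_def of_nat_diff)
    have d: "1 + real d \<le> 2 ^ d"
      using Bernoulli_inequality[of 1 d] by simp
    have "0 \<le> 2 * M * d" using M1 by simp
    moreover have "(2 * M + 1) * (1 + real d) = M + (M + 1 + d) + 2 * M * d"
      by (simp add: algebra_simps)
    ultimately have "M + a \<le> (2 * M + 1) * (1 + real d)" using a by linarith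
    also have "\<dots> \<le> (2 * M + 1) * 2 ^ d"
      using d M1 by (intro mult_left_mono) auto
    \<comment> \<open>The leading factor 2 of \<open>guess_bound\<close> is spent here: for
      \<open>M = 1\<close> the comparison is \<open>3 \<le> 4\<close> and would fail without
      it.\<close>
    also have "\<dots> \<le> (2 * (M * (M * (M + 1)))) * 2 ^ d"
    proof (rule mult_right_mono)
      have "1 * (M * (M + 1)) \<le> M * (M * (M + 1))"
        using M1 by (intro mult_right_mono) auto
      moreover have "1 * (M + 1) \<le> M * (M + 1)"
        using M1 by (intro mult_right_mono) auto
      ultimately have "M + 1 \<le> M * (M * (M + 1))" by (simp only: mult_1)
      then have "2 * (M + 1) \<le> 2 * (M * (M * (M + 1)))" by (rule mult_left_mono) simp
      then show "2 * M + 1 \<le> 2 * (M * (M * (M + 1)))" by (rule order_trans[rotated]) simp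
    qed simp
    finally have "(M + a) * 2 ^ k \<le> (2 * (M * (M * (M + 1)))) * 2 ^ d * 2 ^ k"
      by (rule mult_right_mono) simp
    moreover have "guess_bound r k = 2 ^ k" using True by (simp add: guess_bound_def)
    moreover have "(2::real) ^ r = 2 ^ k * 2 ^ d" by (simp add: r power_add)
    ultimately show ?thesis
      unfolding gm M_def[symmetric] by (simp only: mult_ac)
  next
    case False
    define b where "b = real m - real k"
    have b1: "1 \<le> b" using assms by (simp add: b_def)
    have K: "real (k - r) = M - b" using False assms by (simp add: b_def M_def of_nat_diff)
    have bM: "b \<le> M" using K by (metis diff_ge_0_iff_ge of_nat_0_le_iff)
    have a: "real a \<le> b + 1" using assms(3) by (simp add: b_def)
    \<comment> \<open>Raising \<open>a\<close> to \<open>b + 1\<close> leaves a polynomial in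
      \<open>M\<close> and \<open>b\<close>; the term subtracted next is nonnegative because
      \<open>1 \<le> b\<close> and \<open>b \<le> M\<close>.\<close>
    have "(M + a) * ((M - b) * (M - b + 1)) \<le> (M + (b + 1)) * ((M - b) * (M - b + 1))"
      using a bM by (intro mult_right_mono) auto
    also have "\<dots> = M * (M * (M + 1)) - (b * (M + 1)\<^sup>2 + b\<^sup>2 * (M - b) - M * (M + 1))"
      by (simp add: algebra_simps power2_eq_square)
    also have "\<dots> \<le> M * (M * (M + 1))"
    proof -
      have "1 * (M + 1)\<^sup>2 \<le> b * (M + 1)\<^sup>2" using b1 by (intro mult_right_mono) auto
      moreover have "M * (M + 1) \<le> (M + 1)\<^sup>2" using M1 by (simp add: power2_eq_square)
      moreover have "0 \<le> b\<^sup>2 * (M - b)" using bM by simp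
      ultimately show ?thesis by linarith
    qed
    finally have "2 * 2 ^ r * ((M + a) * ((M - b) * (M - b + 1))) \<le> 2 * 2 ^ r * (M * (M * (M + 1)))"
      by (rule mult_left_mono) simp
    moreover have "guess_bound r k = 2 * 2 ^ r * ((M - b) * (M - b + 1))"
      using False K by (simp add: guess_bound_def add.commute)
    ultimately show ?thesis
      unfolding gm M_def[symmetric] by (simp only: mult.assoc mult.left_commute)
  qed
qed

lemma guess_bound_contract:
  assumes P: "partition_on V P" and finP: "finite P" and I: "hereditary I"
    and e: "2 \<le> card (touched P e)" and m: "r < card (light I P)"
  shows "(real (card (light I P) - r) + real (card (light I P \<inter> touched P e)))
      * guess_bound r (card (light I (contract P e)))
    \<le> real (card (light I P) - r) * guess_bound r (card (light I P))"
    (is "(?M + real ?a) * _ \<le> _")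
proof -
  let ?T = "touched P e" and ?m = "card (light I P)"
  have am: "?a \<le> ?m" using finite_light[OF finP] by (intro card_mono) auto
  have cl: "card (light I (contract P e)) = ?m - ?a + (if I (\<Union>?T) then 1 else 0)"
    using e by (intro card_light_contract[OF P finP]) auto
  show ?thesis
  proof (cases "I (\<Union>?T)")
    case True
    have "light I P \<inter> ?T = ?T" using touched_light[OF I True] by blast
    then show ?thesis using e cl True am m by (intro guess_bound_step) auto
  next
    case False
    show ?thesis
    proof (cases "?a = 0")
      case True
      then show ?thesis using cl False by simp
    next
      case a: False
      \<comment> \<open>All touched light blocks are lost and none is gained, so the recurrence
        applies with \<open>?a + 1\<close>, which is at least 2 even if only one light block is
        touched.\<close>
      have "(?M + real ?a) * guess_bound r (?m - ?a) \<le> (?M + real (?a + 1)) * guess_bound r (?m - ?a)"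
        using guess_bound_pos[of r "?m - ?a"] by (intro mult_right_mono) auto
      also have "\<dots> \<le> ?M * guess_bound r ?m"
        using a am m by (intro guess_bound_step) auto
      finally show ?thesis using cl False by simp
    qed
  qed
qed

section \<open>Cuts and degrees in the contracted hypergraph\<close>

locale weighted_hypergraph =
  fixes V :: "'v set" and E :: "'v set set" and c :: "'v set \<Rightarrow> real"
  assumes fin: "finite V" and edge: "e \<in> E \<Longrightarrow> e \<subseteq> V" and pos: "e \<in> E \<Longrightarrow> 0 < c e"
begin

lemma finite_E: "finite E"
  using fin edge by (meson Pow_iff finite_Pow_iff finite_subset subsetI)

lemma finite_crossing: "finite (crossing E P)"
  using finite_E by (simp add: crossing_def)

text \<open>Minimality is attached to a side \<open>X\<close> rather than to its cut, since
  saturation is a property of the side.\<close>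

definition mincut :: "('v set \<Rightarrow> bool) \<Rightarrow> 'v set \<Rightarrow> bool" where
  "mincut I X \<longleftrightarrow> I X \<and> X \<noteq> {} \<and> X \<subset> V \<and>
     (\<forall>Y. I Y \<and> Y \<noteq> {} \<and> Y \<subset> V \<longrightarrow> sum c (cut V E X) \<le> sum c (cut V E Y))"

lemma cut_subset_crossing:
  assumes "partition_on V P" "saturated P X"
  shows "cut V E X \<subseteq> crossing E P"
proof
  fix e assume e: "e \<in> cut V E X"
  then obtain x y where xy: "x \<in> e" "x \<in> X" "y \<in> e" "y \<in> V" "y \<notin> X" "e \<in> E"
    by (auto simp: cut_def)
  then obtain A B where AB: "A \<in> P" "x \<in> A" "B \<in> P" "y \<in> B"
    using partition_onD1[OF assms(1)] edge by blast
  have "A \<noteq> B" using AB xy assms(2) by (auto simp: saturated_def)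
  moreover have "{A, B} \<subseteq> touched P e" using AB xy by (auto simp: touched_def)
  moreover have "finite (touched P e)"
    using touched_subset finite_elements[OF fin assms(1)] finite_subset by metis
  ultimately have "2 \<le> card (touched P e)"
    using card_mono[of "touched P e" "{A, B}"] by auto
  then show "e \<in> crossing E P" using xy by (simp add: crossing_def)
qed

text \<open>With blocks as vertices this is the star of \<open>B\<close>: a crossing hyperedge that
  touches \<open>B\<close> also touches another block, which is disjoint from
  \<open>B\<close>.\<close>

lemma cut_block:
  assumes P: "partition_on V P" and B: "B \<in> P"
  shows "cut V E B = {e \<in> crossing E P. B \<in> touched P e}"
proof
  have "saturated P B"
    using partition_onD2[OF P] B by (auto simp: saturated_def disjoint_def)
  then show "cut V E B \<subseteq> {e \<in> crossing E P. B \<in> touched P e}"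
    using cut_subset_crossing[OF P] B by (auto simp: cut_def touched_def)
  show "{e \<in> crossing E P. B \<in> touched P e} \<subseteq> cut V E B"
  proof
    fix e assume "e \<in> {e \<in> crossing E P. B \<in> touched P e}"
    then have e: "e \<in> E" "2 \<le> card (touched P e)" "B \<in> touched P e"
      by (auto simp: crossing_def)
    have "\<not> touched P e \<subseteq> {B}"
      using card_mono[of "{B}" "touched P e"] e(2) by auto
    then obtain A where A: "A \<in> touched P e" "A \<noteq> B" by auto
    then have "A \<inter> B = {}" "A \<inter> e \<noteq> {}"
      using partition_onD2[OF P] B by (auto simp: disjoint_def touched_def)
    then show "e \<in> cut V E B"
      using e edge[OF e(1)] by (auto simp: cut_def touched_def)
  qed
qed

text \<open>The star of each light block costs at least as much as the minimum cut; the right-hand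
  side counts pairs of a light block and a crossing hyperedge touching it, weighted by cost.\<close>

lemma light_degree_sum:
  assumes P: "partition_on V P" and X: "mincut I X" "saturated P X"
  shows "real (card (light I P)) * sum c (cut V E X)
    \<le> (\<Sum>e\<in>crossing E P. c e * real (card (light I P \<inter> touched P e)))"
proof -
  have finP: "finite P" using finite_elements[OF fin P] .
  have "sum c (cut V E X) \<le> sum c (cut V E B)" if B: "B \<in> light I P" for B
  proof -
    have BP: "B \<in> P" "I B" using B by (auto simp: light_def)
    have "B \<noteq> {}" "B \<subseteq> V" using BP P partition_onD3 partition_onD1 by blast+
    \<comment> \<open>If \<open>V\<close> were a block, saturation would make \<open>X\<close> empty
      or all of \<open>V\<close>.\<close>
    moreover have "B \<noteq> V"
      using X BP by (auto simp: mincut_def saturated_def)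
    ultimately show ?thesis using X(1) BP(2) by (auto simp: mincut_def)
  qed
  then have "real (card (light I P)) * sum c (cut V E X) \<le> (\<Sum>B\<in>light I P. sum c (cut V E B))"
    by (rule sum_bounded_below)
  also have "\<dots> = (\<Sum>B\<in>light I P. \<Sum>e\<in>crossing E P. if B \<in> touched P e then c e else 0)"
  proof (rule sum.cong)
    fix B assume "B \<in> light I P"
    then have "B \<in> P" by (simp add: light_def)
    then show "sum c (cut V E B) = (\<Sum>e\<in>crossing E P. if B \<in> touched P e then c e else 0)"
      by (simp add: cut_block[OF P] finite_crossing sum.inter_filter)
  qed simp
  also have "\<dots> = (\<Sum>e\<in>crossing E P. \<Sum>B\<in>light I P. if B \<in> touched P e then c e else 0)"
    by (rule sum.swap)
  also have "\<dots> = (\<Sum>e\<in>crossing E P. c e * real (card (light I P \<inter> touched P e)))"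
    by (intro sum.cong) (simp_all add: sum.inter_restrict[symmetric] finite_light[OF finP])
  finally show ?thesis .
qed

lemma block_in_light:
  assumes "hereditary I" "I X"
  shows "{B \<in> P. B \<subseteq> X} \<subseteq> light I P"
  using assms by (auto simp: hereditary_def light_def)

section \<open>Fixed budget: counting by averaging over contractions\<close>

text \<open>
  The cut around the union of all light blocks is excluded because it survives even the contraction
  of an edge meeting every light block. It stays excluded under contraction, except when
  light blocks are merged into a heavy one; \<open>card_avoiding_le\<close> then adds it back.
\<close>

definition split_light_mincuts :: "('v set \<Rightarrow> bool) \<Rightarrow> 'v set set \<Rightarrow> 'v set set set" where
  "split_light_mincuts I P =
     {cut V E X | X. mincut I X \<and> saturated P X \<and> X \<noteq> \<Union>(light I P)}"

lemma finite_split_light_mincuts: "finite (split_light_mincuts I P)"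
  by (rule finite_subset[of _ "Pow E"]) (auto simp: split_light_mincuts_def cut_def finite_E)

text \<open>\<open>X\<close> is a union of blocks, all light by heredity. If no light block lay
  outside, \<open>X\<close> would be the excluded union.\<close>

lemma split_light:
  assumes P: "partition_on V P" and I: "hereditary I"
    and X: "mincut I X" "saturated P X" "X \<noteq> \<Union>(light I P)"
  obtains A B where "A \<in> light I P" "A \<subseteq> X" "B \<in> light I P" "B \<inter> X = {}"
proof -
  have XV: "X \<subseteq> V" "X \<noteq> {}" "I X" using X(1) by (auto simp: mincut_def)
  have U: "X = \<Union>{B \<in> P. B \<subseteq> X}" by (rule saturated_Union[OF P X(2) XV(1)])
  have sub: "{B \<in> P. B \<subseteq> X} \<subseteq> light I P" by (rule block_in_light[OF I XV(3)])
  have "{B \<in> P. B \<subseteq> X} \<noteq> {}" using U XV(2) by auto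
  then obtain A where A: "A \<subseteq> X" "A \<in> light I P" using sub by blast
  have "\<not> (\<forall>B\<in>light I P. B \<subseteq> X)"
  proof
    assume "\<forall>B\<in>light I P. B \<subseteq> X"
    then have "light I P = {B \<in> P. B \<subseteq> X}" using sub by (auto simp: light_def)
    then show False using X(3) U by simp
  qed
  then obtain B where B: "B \<in> light I P" "\<not> B \<subseteq> X" by blast
  then have "B \<inter> X = {}" using X(2) by (auto simp: light_def saturated_def)
  then show ?thesis by (rule that[OF A(2,1) B(1)])
qed

lemma cut_if_touches_all_light:
  assumes P: "partition_on V P" and I: "hereditary I"
    and X: "mincut I X" "saturated P X" "X \<noteq> \<Union>(light I P)"
    and e: "e \<in> E" "light I P \<subseteq> touched P e"
  shows "e \<in> cut V E X"
proof -
  obtain A B where AB: "A \<in> light I P" "A \<subseteq> X" "B \<in> light I P" "B \<inter> X = {}"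
    using split_light[OF P I X] .
  then have "A \<inter> e \<noteq> {}" "B \<inter> e \<noteq> {}" using e(2) by (auto simp: touched_def)
  then show ?thesis using e edge[OF e(1)] AB unfolding cut_def by blast
qed

text \<open>One contraction step of the count. The bound keeps the factor \<open>m - a\<close>, with
  \<open>m\<close> the number of light blocks and \<open>a\<close> the number of those touched,
  because its weighted sum over all crossing hyperedges is what the averaging argument
  cancels.\<close>

lemma card_avoiding_le:
  assumes P: "partition_on V P" and I: "hereditary I" and e: "e \<in> crossing E P"
    and IH: "card (split_light_mincuts I (contract P e))
      \<le> card (light I (contract P e)) * (card (light I (contract P e)) - 1)"
  shows "card {F \<in> split_light_mincuts I P. e \<notin> F}
      \<le> (card (light I P) - card (light I P \<inter> touched P e)) * (card (light I P) - 1)"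
    (is "card ?S \<le> (?m - ?a) * _")
proof (cases "light I P \<subseteq> touched P e")
  case True
  then have "?S = {}"
    using cut_if_touches_all_light[OF P I] e by (auto simp: split_light_mincuts_def crossing_def)
  then show ?thesis by (metis card.empty le0)
next
  case False
  let ?P = "contract P e" and ?T = "touched P e"
  have finP: "finite P" using finite_elements[OF fin P] .
  have eE: "e \<in> E" "2 \<le> card ?T" using e by (auto simp: crossing_def)
  then have ne: "?T \<noteq> {}" by auto
  have am: "?a < ?m"
    using False finite_light[OF finP, of I] by (intro psubset_card_mono) auto
  have cl: "card (light I ?P) = ?m - ?a + (if I (\<Union>?T) then 1 else 0)"
    by (rule card_light_contract[OF P finP ne])
  \<comment> \<open>A cut avoiding \<open>e\<close> stays saturated; it leaves the family only if
    its side has become the union of the light blocks.\<close>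
  have sub0: "F = cut V E (\<Union>(light I ?P)) \<and> \<Union>(light I ?P) \<noteq> \<Union>(light I P) \<or> F \<in> split_light_mincuts I ?P"
    if F: "F \<in> ?S" for F
  proof -
    obtain X where X: "mincut I X" "saturated P X" "X \<noteq> \<Union>(light I P)" "F = cut V E X" "e \<notin> F"
      using F by (auto simp: split_light_mincuts_def)
    have "saturated ?P X"
      using saturated_contract[OF X(2) edge[OF eE(1)] eE(1)] X(4,5) by simp
    then show ?thesis using X unfolding split_light_mincuts_def by blast
  qed
  then have sub: "?S \<subseteq> insert (cut V E (\<Union>(light I ?P))) (split_light_mincuts I ?P)"
    by blast
  have finS: "finite (split_light_mincuts I ?P)" by (rule finite_split_light_mincuts)
  show ?thesis
  \<comment> \<open>In the first case the union of the light blocks is unchanged: either the touched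
    blocks are all light and merge into a light one, or no light block is touched.\<close>
  proof (cases "?a = 0 \<or> I (\<Union>?T)")
    case True
    have "\<Union>(light I ?P) = \<Union>(light I P)"
    proof (cases "I (\<Union>?T)")
      case True
      then show ?thesis
        using light_contract[OF P ne, of I] touched_light[OF I True] by auto
    next
      case False
      then have "light I P \<inter> ?T = {}" using \<open>?a = 0 \<or> I (\<Union>?T)\<close> finite_light[OF finP, of I] by auto
      then have "light I P - ?T = light I P" by blast
      then show ?thesis using light_contract[OF P ne, of I] False by simp
    qed
    then have "?S \<subseteq> split_light_mincuts I ?P"
      using sub0 by blast
    then have S: "card ?S \<le> card (light I ?P) * (card (light I ?P) - 1)"
      using card_mono[OF finS] IH le_trans by blast
    show ?thesis
    proof (cases "I (\<Union>?T)")
      case True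
      have "light I P \<inter> ?T = ?T" using touched_light[OF I True] by blast
      then have a2: "2 \<le> ?a" using eE by simp
      have "card (light I ?P) * (card (light I ?P) - 1) = (?m - ?a) * (?m - ?a + 1)"
        using cl True by simp
      also have "\<dots> \<le> (?m - ?a) * (?m - 1)" using a2 am by (intro mult_le_mono) auto
      finally show ?thesis using S by linarith
    next
      case False
      then show ?thesis using S cl True by simp
    qed
  next
    case False
    then have a1: "1 \<le> ?a" and k: "card (light I ?P) = ?m - ?a" using cl by auto
    \<comment> \<open>Light blocks vanish into a heavy one, so one cut may leave the family; the
      term \<open>(?m - ?a) * ?a\<close>, at least 1, pays for it.\<close>
    have "card ?S \<le> Suc (card (split_light_mincuts I ?P))"
      by (rule order_trans[OF card_mono[OF _ sub]]) (use finS in \<open>auto simp: card_insert_if\<close>)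
    also have "\<dots> \<le> Suc ((?m - ?a) * (?m - ?a - 1))" using IH k by simp
    also have "\<dots> \<le> (?m - ?a) * (?m - ?a - 1) + (?m - ?a) * ?a"
      using a1 am by simp
    also have "\<dots> = (?m - ?a) * (?m - 1)"
      using am by (simp add: distrib_left[symmetric])
    finally show ?thesis .
  qed
qed

text \<open>Pairs of a cut \<open>F\<close> and a crossing hyperedge outside \<open>F\<close> are
  counted with weight \<open>c e\<close>. Each \<open>F\<close> contributes at least
  \<open>Z / m\<close>, and by induction all pairs together weigh at most
  \<open>Z * (m - 1)\<close>.\<close>

lemma card_split_light_mincuts:
  assumes "partition_on V P" "hereditary I"
  shows "card (split_light_mincuts I P) \<le> card (light I P) * (card (light I P) - 1)"
  using assms(1)
proof (induction "card P" arbitrary: P rule: less_induct)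
  case less
  note P = less.prems
  let ?S = "split_light_mincuts I P" and ?EP = "crossing E P"
  let ?m = "card (light I P)" and ?a = "\<lambda>e. card (light I P \<inter> touched P e)"
  have finP: "finite P" using finite_elements[OF fin P] .
  have finL: "finite (light I P)" by (rule finite_light[OF finP])
  have am: "?a e \<le> ?m" for e using finL by (intro card_mono) auto
  have posE: "0 < c e" if "e \<in> ?EP" for e using that pos by (simp add: crossing_def)
  show ?case
  proof (cases "?S = {}")
    case True
    then show ?thesis by simp
  next
    case False
    then obtain X where X: "mincut I X" "saturated P X" "X \<noteq> \<Union>(light I P)"
      by (auto simp: split_light_mincuts_def)
    obtain A B where AB: "A \<in> light I P" "A \<subseteq> X" "B \<in> light I P" "B \<inter> X = {}"
      using split_light[OF P assms(2) X] .
    have "A \<noteq> {}" using AB(1) partition_onD3[OF P] by (auto simp: light_def)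
    then have "A \<noteq> B" using AB by blast
    then have m2: "2 \<le> ?m" using card_mono[OF finL, of "{A, B}"] AB by auto
    \<comment> \<open>By \<open>light_degree_sum\<close>, \<open>Z\<close> is at most
      \<open>?m\<close> times the cost of the crossing hyperedges outside any cut counted.\<close>
    define Z where "Z = (\<Sum>e\<in>?EP. c e * (real ?m - real (?a e)))"
    have Z0: "0 \<le> Z"
      unfolding Z_def by (intro sum_nonneg mult_nonneg_nonneg) (use posE am in \<open>auto intro: less_imp_le\<close>)
    show ?thesis
    \<comment> \<open>If \<open>Z = 0\<close>, every crossing edge meets all light blocks and lies in every cut counted.\<close>
    proof (cases "Z = 0")
      case True
      have "c e * (real ?m - real (?a e)) = 0" if "e \<in> ?EP" for e
      proof -
        have "0 \<le> c f * (real ?m - real (?a f))" if "f \<in> ?EP" for f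
          using posE[OF that] am by (simp add: less_imp_le)
        then show ?thesis
          using True that finite_crossing[of P] unfolding Z_def by (simp add: sum_nonneg_eq_0_iff)
      qed
      then have all: "light I P \<subseteq> touched P e" if "e \<in> ?EP" for e
        using that posE[OF that] finL card_subset_eq[OF finL, of "light I P \<inter> touched P e"] by force
      have "?S \<subseteq> {?EP}"
      proof
        fix F assume "F \<in> ?S"
        then obtain Y where Y: "mincut I Y" "saturated P Y" "Y \<noteq> \<Union>(light I P)" "F = cut V E Y"
          by (auto simp: split_light_mincuts_def)
        have "?EP \<subseteq> F"
          using cut_if_touches_all_light[OF P assms(2) Y(1-3)] all Y(4) by (auto simp: crossing_def)
        then show "F \<in> {?EP}" using cut_subset_crossing[OF P Y(2)] Y(4) by auto
      qed
      then have "card ?S \<le> 1" using card_mono[of "{?EP}" ?S] by simp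
      also have "1 \<le> ?m * (?m - 1)" using m2 by (cases ?m) auto
      finally show ?thesis .
    next
      case False
      then have Zpos: "0 < Z" using Z0 by simp
      have IH: "card {F \<in> ?S. e \<notin> F} \<le> (?m - ?a e) * (?m - 1)" if e: "e \<in> ?EP" for e
      proof (rule card_avoiding_le[OF P assms(2) e])
        have "2 \<le> card (touched P e)" using e by (simp add: crossing_def)
        moreover then have "touched P e \<noteq> {}" by auto
        ultimately show "card (split_light_mincuts I (contract P e))
          \<le> card (light I (contract P e)) * (card (light I (contract P e)) - 1)"
          using less.hyps card_contract[OF P finP] partition_on_contract[OF P] by blast
      qed
      have surv: "Z / ?m \<le> sum c (?EP - F)" if F: "F \<in> ?S" for F
      proof -
        obtain Y where Y: "mincut I Y" "saturated P Y" "F = cut V E Y"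
          using F by (auto simp: split_light_mincuts_def)
        have "sum c (?EP - F) = sum c ?EP - sum c F"
          using cut_subset_crossing[OF P Y(2)] Y(3) finite_crossing by (intro sum_diff) auto
        moreover have "real ?m * sum c F \<le> (\<Sum>e\<in>?EP. c e * real (?a e))"
          using light_degree_sum[OF P Y(1,2)] Y(3) by simp
        moreover have "Z = real ?m * sum c ?EP - (\<Sum>e\<in>?EP. c e * real (?a e))"
          unfolding Z_def by (simp add: algebra_simps sum_subtractf sum_distrib_left sum_distrib_right)
        ultimately have "Z \<le> real ?m * sum c (?EP - F)" by (simp add: right_diff_distrib)
        then show ?thesis using m2 by (simp add: divide_le_eq mult.commute)
      qed
      have "real (card ?S) * (Z / ?m) \<le> (\<Sum>F\<in>?S. sum c (?EP - F))"
        using surv by (rule sum_bounded_below)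
      also have "\<dots> = (\<Sum>F\<in>?S. \<Sum>e\<in>?EP. if e \<notin> F then c e else 0)"
        by (simp only: set_diff_eq sum.inter_filter[OF finite_crossing])
      also have "\<dots> = (\<Sum>e\<in>?EP. \<Sum>F\<in>?S. if e \<notin> F then c e else 0)"
        by (rule sum.swap)
      also have "\<dots> = (\<Sum>e\<in>?EP. c e * real (card {F \<in> ?S. e \<notin> F}))"
        by (intro sum.cong refl)
          (simp add: sum.inter_filter[symmetric] finite_split_light_mincuts)
      also have "\<dots> \<le> (\<Sum>e\<in>?EP. c e * real ((?m - ?a e) * (?m - 1)))"
        using IH posE by (intro sum_mono mult_left_mono) (auto intro: less_imp_le simp del: of_nat_mult)
      also have "\<dots> = Z * real (?m - 1)"
        unfolding Z_def sum_distrib_right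
        by (intro sum.cong refl) (simp add: of_nat_diff am)
      finally have "real (card ?S) * Z \<le> Z * real (?m - 1) * ?m"
        using m2 by (simp add: field_simps)
      then have "real (card ?S) \<le> real (?m - 1) * ?m" using Zpos by (simp add: mult.assoc mult.commute)
      then have "real (card ?S) \<le> real (?m * (?m - 1))" by (simp add: mult.commute)
      then show ?thesis by (simp only: of_nat_le_iff)
    qed
  qed
qed

section \<open>Varying budgets: weighted counting along a common contraction order\<close>

text \<open>After division by the total crossing cost, this bounds the survival probability by its
  mean after one contraction. Hyperedges of the cut touch at most \<open>r\<close> light blocks, so
  subtracting their share from the degree bound replaces \<open>m\<close> by \<open>m - r\<close>,
  matching \<open>guess_bound_contract\<close>.\<close>

lemma degree_survival:
  assumes P: "partition_on V P" and I: "hereditary I"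
    and X: "mincut I X" "saturated P X"
    and r: "\<And>e. e \<in> E \<Longrightarrow> card e \<le> r" and m: "r < card (light I P)"
  shows "sum c (crossing E P) / guess_bound r (card (light I P))
    \<le> (\<Sum>e\<in>crossing E P - cut V E X. c e / guess_bound r (card (light I (contract P e))))"
proof -
  let ?EP = "crossing E P" and ?F = "cut V E X" and ?m = "card (light I P)"
  let ?a = "\<lambda>e. card (light I P \<inter> touched P e)" and ?g = "guess_bound r"
  define M where "M = real (?m - r)"
  have Mpos: "0 < M" using m by (simp add: M_def)
  have finP: "finite P" using finite_elements[OF fin P] .
  have FE: "?F \<subseteq> ?EP" by (rule cut_subset_crossing[OF P X(2)])
  have posE: "0 < c e" if "e \<in> ?EP" for e using that pos by (simp add: crossing_def)
  have ar: "?a e \<le> r" if "e \<in> ?EP" for e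
  proof -
    have eE: "e \<in> E" using that by (simp add: crossing_def)
    then have "finite e" using edge fin finite_subset by metis
    then have "card (touched P e) \<le> card e" by (rule card_touched_le[OF P])
    moreover have "?a e \<le> card (touched P e)"
      using finite_subset[OF touched_subset finP] by (intro card_mono) auto
    ultimately show ?thesis using r[OF eE] by linarith
  qed
  have split: "sum f ?EP = sum f (?EP - ?F) + sum f ?F" for f :: "'v set \<Rightarrow> real"
    by (rule sum.subset_diff[OF FE finite_crossing])
  have "(\<Sum>e\<in>?F. c e * real (?a e)) \<le> (\<Sum>e\<in>?F. c e * real r)"
    using ar posE FE by (intro sum_mono mult_left_mono) (auto intro: less_imp_le)
  also have "\<dots> = real r * sum c ?F" by (simp add: sum_distrib_left mult.commute)
  finally have "real ?m * sum c ?F \<le> (\<Sum>e\<in>?EP - ?F. c e * real (?a e)) + real r * sum c ?F"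
    using light_degree_sum[OF P X] split[of "\<lambda>e. c e * real (?a e)"] by linarith
  then have deg: "M * sum c ?F \<le> (\<Sum>e\<in>?EP - ?F. c e * real (?a e))"
    using m by (simp add: M_def of_nat_diff algebra_simps)
  have step: "c e * (M + real (?a e)) / (M * ?g ?m) \<le> c e / ?g (card (light I (contract P e)))"
    if e: "e \<in> ?EP" for e
  proof -
    have "(M + real (?a e)) * ?g (card (light I (contract P e))) \<le> M * ?g ?m"
      using guess_bound_contract[OF P finP I _ m] e unfolding M_def by (simp add: crossing_def)
    then have "(M + real (?a e)) / (M * ?g ?m) \<le> 1 / ?g (card (light I (contract P e)))"
      using Mpos by (simp add: field_simps guess_bound_pos)
    then show ?thesis using mult_left_mono[OF _ less_imp_le[OF posE[OF e]]] by fastforce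
  qed
  have "sum c ?EP / ?g ?m = (M * sum c (?EP - ?F) + M * sum c ?F) / (M * ?g ?m)"
    using Mpos split[of c] by (simp add: distrib_left[symmetric])
  also have "\<dots> \<le> (M * sum c (?EP - ?F) + (\<Sum>e\<in>?EP - ?F. c e * real (?a e))) / (M * ?g ?m)"
    using deg Mpos guess_bound_pos[of r ?m] by (intro divide_right_mono) auto
  also have "\<dots> = (\<Sum>e\<in>?EP - ?F. c e * (M + real (?a e)) / (M * ?g ?m))"
    by (simp add: sum_divide_distrib[symmetric] distrib_left sum.distrib sum_distrib_left mult.commute)
  also have "\<dots> \<le> (\<Sum>e\<in>?EP - ?F. c e / ?g (card (light I (contract P e))))"
    using step by (intro sum_mono) auto
  finally show ?thesis .
qed

text \<open>Every cut has its own side and budget, but all share the partition \<open>P\<close> with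
  \<open>k\<close> blocks. Cuts with at most \<open>r\<close> light blocks contribute at most
  \<open>r * k ^ (t - 1)\<close>, one unit per threshold set; the others at most
  \<open>r * (k - 1) ^ t\<close> by induction. The two add up to at most
  \<open>r * k ^ t\<close>.\<close>

lemma sum_inverse_guess_bound_le:
  assumes t: "1 \<le> t" and w: "\<And>i v. i \<in> {1..t} \<Longrightarrow> v \<in> V \<Longrightarrow> 0 \<le> w i v"
    and r: "\<And>e. e \<in> E \<Longrightarrow> card e \<le> r"
    and "partition_on V P" "finite S"
    and "\<And>F. F \<in> S \<Longrightarrow> F \<noteq> {} \<and> F = cut V E (X F) \<and> mincut (feasible V t w (b F)) (X F) \<and> saturated P (X F)"
  shows "(\<Sum>F\<in>S. 1 / guess_bound r (card (light (feasible V t w (b F)) P))) \<le> real r * real (card P) ^ t"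
  using assms(4-)
proof (induction "card P" arbitrary: P S rule: less_induct)
  case less
  note P = less.prems(1) and finS = less.prems(2) and S = less.prems(3)
  let ?L = "\<lambda>P F. light (feasible V t w (b F)) P" and ?g = "guess_bound r" and ?k = "card P"
  let ?EP = "crossing E P"
  have finP: "finite P" using finite_elements[OF fin P] .
  have her: "hereditary (feasible V t w d)" for d
    by (rule hereditary_feasible[OF fin w])
  have sub: "{B \<in> P. B \<subseteq> X F} \<subseteq> ?L P F" if "F \<in> S" for F
    using block_in_light[OF her] S[OF that] by (auto simp: mincut_def)
  have rep: "X F = \<Union>{B \<in> P. B \<subseteq> X F}" if "F \<in> S" for F
    using saturated_Union[OF P] S[OF that] by (auto simp: mincut_def)
  show ?case
  proof (cases "S = {}")
    case True
    then show ?thesis by simp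
  next
    case False
    then have k1: "1 \<le> ?k"
    proof -
      obtain F where F: "F \<in> S" using False by blast
      then have "X F \<noteq> {}" using S by (simp add: mincut_def)
      then have "P \<noteq> {}" using rep[OF F] by auto
      then show ?thesis using finP by (simp add: Suc_le_eq card_gt_0_iff)
    qed
    define A where "A = {F \<in> S. card (?L P F) \<le> r}"
    define B where "B = {F \<in> S. r < card (?L P F)}"
    have finAB: "finite A" "finite B" using finS by (auto simp: A_def B_def)
    have AS: "F \<in> S" if "F \<in> A" for F using that by (simp add: A_def)
    have BS: "F \<in> S" if "F \<in> B" for F using that by (simp add: B_def)
    \<comment> \<open>Once the light set \<open>L\<close> is fixed, a cut is determined by the
      blocks inside its side, a subset of \<open>L\<close>; the weight \<open>1 / 2 ^ card L\<close>
      compensates for these guesses.\<close>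
    have fiber: "card {F \<in> A. ?L P F = L} \<le> 2 ^ card L" if L: "L \<in> ?L P ` A" for L
    proof -
      have finL: "finite L" using L finite_light[OF finP] by auto
      have "inj_on (\<lambda>F. {B \<in> P. B \<subseteq> X F}) {F \<in> A. ?L P F = L}"
      proof (rule inj_onI)
        fix F F' assume "F \<in> {F \<in> A. ?L P F = L}" "F' \<in> {F \<in> A. ?L P F = L}"
          and eq: "{B \<in> P. B \<subseteq> X F} = {B \<in> P. B \<subseteq> X F'}"
        then have F: "F \<in> S" "F' \<in> S" using AS by auto
        have "X F = \<Union>{B \<in> P. B \<subseteq> X F}" by (rule rep[OF F(1)])
        also have "\<dots> = X F'" unfolding eq by (rule rep[OF F(2), symmetric])
        finally have "cut V E (X F) = cut V E (X F')" by simp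
        then show "F = F'" using S[OF F(1)] S[OF F(2)] by simp
      qed
      moreover have "(\<lambda>F. {B \<in> P. B \<subseteq> X F}) ` {F \<in> A. ?L P F = L} \<subseteq> Pow L"
        using sub AS by fastforce
      ultimately have "card {F \<in> A. ?L P F = L} \<le> card (Pow L)"
        using finL by (intro card_inj_on_le) auto
      then show ?thesis using finL by (simp add: card_Pow)
    qed
    have "(\<Sum>F\<in>A. 1 / ?g (card (?L P F))) = (\<Sum>L\<in>?L P ` A. \<Sum>F\<in>{F \<in> A. ?L P F = L}. 1 / ?g (card (?L P F)))"
      by (rule sum.image_gen[OF finAB(1)])
    also have "\<dots> \<le> (\<Sum>L\<in>?L P ` A. 1)"
    proof (rule sum_mono)
      fix L assume L: "L \<in> ?L P ` A"
      then have "card L \<le> r" by (auto simp: A_def)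
      then have "(\<Sum>F\<in>{F \<in> A. ?L P F = L}. 1 / ?g (card (?L P F))) = real (card {F \<in> A. ?L P F = L}) / 2 ^ card L"
        by (simp add: guess_bound_def)
      also have "\<dots> \<le> 1" using fiber[OF L] by (simp add: divide_le_eq)
      finally show "(\<Sum>F\<in>{F \<in> A. ?L P F = L}. 1 / ?g (card (?L P F))) \<le> 1" .
    qed
    also have "\<dots> = real (card (?L P ` A))" by simp
    also have "\<dots> \<le> real (r * ?k ^ (t - 1))"
    proof -
      let ?Th = "{T. T \<noteq> {} \<and> card T \<le> r \<and> (\<exists>d. T = {B \<in> P. \<forall>i\<in>{1..t}. sum (w i) B \<le> d i})}"
      have "?L P ` A \<subseteq> ?Th"
      proof
        fix L assume "L \<in> ?L P ` A"
        then obtain F where F: "F \<in> A" "L = ?L P F" by auto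
        have "{B \<in> P. B \<subseteq> X F} \<noteq> {}" using rep[OF AS[OF F(1)]] S[OF AS[OF F(1)]] by (auto simp: mincut_def)
        then have "L \<noteq> {}" using sub[OF AS[OF F(1)]] F(2) by blast
        moreover have "card L \<le> r" using F by (simp add: A_def)
        \<comment> \<open>Blocks are subsets of \<open>V\<close>, so for them feasibility is just a
          system of thresholds.\<close>
        moreover have "L = {B \<in> P. \<forall>i\<in>{1..t}. sum (w i) B \<le> b F i}"
          using F(2) partition_onD1[OF P] by (auto simp: light_def feasible_def)
        ultimately show "L \<in> ?Th" by blast
      qed
      moreover have "finite ?Th" by (rule finite_subset[of _ "Pow P"]) (use finP in auto)
      ultimately have "card (?L P ` A) \<le> card ?Th" by (intro card_mono)
      also have "\<dots> \<le> r * ?k ^ (t - 1)" by (rule card_threshold_sets_le[OF finP t])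
      finally show ?thesis by (simp only: of_nat_le_iff)
    qed
    finally have small: "(\<Sum>F\<in>A. 1 / ?g (card (?L P F))) \<le> real r * real ?k ^ (t - 1)" by simp
    have large: "(\<Sum>F\<in>B. 1 / ?g (card (?L P F))) \<le> real r * (real ?k - 1) ^ t"
    proof (cases "B = {}")
      case True
      then show ?thesis using k1 by simp
    next
      case False
      then obtain F0 where F0: "F0 \<in> B" by blast
      \<comment> \<open>A nonempty cut makes the total crossing cost positive, so that it can be
        cancelled at the end.\<close>
      have "F0 \<subseteq> ?EP" "F0 \<noteq> {}"
        using S[OF BS[OF F0]] cut_subset_crossing[OF P] by metis+
      then have Cpos: "0 < sum c ?EP"
        using pos finite_crossing by (intro sum_pos) (auto simp: crossing_def)
      have IH: "(\<Sum>F\<in>{F \<in> B. e \<notin> F}. 1 / ?g (card (?L (contract P e) F))) \<le> real r * (real ?k - 1) ^ t"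
        if e: "e \<in> ?EP" for e
      proof -
        have e': "2 \<le> card (touched P e)" "e \<in> E" using e by (auto simp: crossing_def)
        then have ne: "touched P e \<noteq> {}" by auto
        have lt: "card (contract P e) < ?k" by (rule card_contract[OF P finP e'(1)])
        have "(\<Sum>F\<in>{F \<in> B. e \<notin> F}. 1 / ?g (card (?L (contract P e) F)))
            \<le> real r * real (card (contract P e)) ^ t"
        proof (rule less.hyps[OF lt partition_on_contract[OF P ne]])
          show "finite {F \<in> B. e \<notin> F}" using finAB by simp
          fix F assume "F \<in> {F \<in> B. e \<notin> F}"
          then have F: "F \<in> S" "e \<notin> F" using BS by auto
          have "saturated (contract P e) (X F)"
            using saturated_contract[OF _ edge[OF e'(2)] e'(2)] S[OF F(1)] F(2) by metis
          then show "F \<noteq> {} \<and> F = cut V E (X F) \<and> mincut (feasible V t w (b F)) (X F)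
              \<and> saturated (contract P e) (X F)"
            using S[OF F(1)] by blast
        qed
        also have "\<dots> \<le> real r * (real ?k - 1) ^ t"
          using lt by (intro mult_left_mono power_mono) auto
        finally show ?thesis .
      qed
      have "sum c ?EP * (\<Sum>F\<in>B. 1 / ?g (card (?L P F))) = (\<Sum>F\<in>B. sum c ?EP / ?g (card (?L P F)))"
        by (simp add: sum_distrib_left)
      also have "\<dots> \<le> (\<Sum>F\<in>B. \<Sum>e\<in>?EP - F. c e / ?g (card (?L (contract P e) F)))"
      proof (rule sum_mono)
        fix F assume F: "F \<in> B"
        have "sum c ?EP / ?g (card (?L P F))
            \<le> (\<Sum>e\<in>?EP - cut V E (X F). c e / ?g (card (?L (contract P e) F)))"
          using S[OF BS[OF F]] F by (intro degree_survival[OF P her _ _ r]) (auto simp: B_def)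
        then show "sum c ?EP / ?g (card (?L P F)) \<le> (\<Sum>e\<in>?EP - F. c e / ?g (card (?L (contract P e) F)))"
          using S[OF BS[OF F]] by metis
      qed
      also have "\<dots> = (\<Sum>F\<in>B. \<Sum>e\<in>?EP. if e \<notin> F then c e / ?g (card (?L (contract P e) F)) else 0)"
        by (simp only: set_diff_eq sum.inter_filter[OF finite_crossing])
      also have "\<dots> = (\<Sum>e\<in>?EP. \<Sum>F\<in>B. if e \<notin> F then c e / ?g (card (?L (contract P e) F)) else 0)"
        by (rule sum.swap)
      also have "\<dots> = (\<Sum>e\<in>?EP. c e * (\<Sum>F\<in>{F \<in> B. e \<notin> F}. 1 / ?g (card (?L (contract P e) F))))"
        by (simp add: sum.inter_filter[OF finAB(2), symmetric] sum_distrib_left)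
      also have "\<dots> \<le> (\<Sum>e\<in>?EP. c e * (real r * (real ?k - 1) ^ t))"
        using IH pos by (intro sum_mono mult_left_mono) (auto simp: crossing_def intro: less_imp_le)
      also have "\<dots> = sum c ?EP * (real r * (real ?k - 1) ^ t)"
        by (simp add: sum_distrib_right)
      finally show ?thesis using Cpos by (simp only: mult_le_cancel_left_pos)
    qed
    have "(\<Sum>F\<in>S. 1 / ?g (card (?L P F))) = (\<Sum>F\<in>A. 1 / ?g (card (?L P F))) + (\<Sum>F\<in>B. 1 / ?g (card (?L P F)))"
    proof -
      have "S = A \<union> B" "A \<inter> B = {}" by (auto simp: A_def B_def)
      then show ?thesis using sum.union_disjoint[OF finAB] by simp
    qed
    also have "\<dots> \<le> real r * real ?k ^ (t - 1) + real r * ((real ?k - 1) * (real ?k - 1) ^ (t - 1))"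
      using small large power_Suc[of "real ?k - 1" "t - 1"] t by simp
    also have "\<dots> \<le> real r * real ?k ^ (t - 1) + real r * ((real ?k - 1) * real ?k ^ (t - 1))"
      using k1 by (intro add_left_mono mult_left_mono power_mono) auto
    also have "\<dots> = real r * real ?k ^ t"
      using power_Suc[of "real ?k" "t - 1"] t by (simp add: algebra_simps)
    finally show ?thesis .
  qed
qed

section \<open>The bounds for the uncontracted hypergraph, as the partition into singletons\<close>

lemma mincut_budget:
  "budget_min_cut V E c t w b F \<longleftrightarrow> (\<exists>X. mincut (feasible V t w b) X \<and> F = cut V E X)"
  by (auto simp: budget_min_cut_def mincut_def)

lemma partition_on_singletons: "partition_on V ((\<lambda>v. {v}) ` V)"
  by (auto simp: partition_on_def disjoint_def)

lemma saturated_singletons: "saturated ((\<lambda>v. {v}) ` V) X"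
  by (auto simp: saturated_def)

lemma card_light_singletons: "card (light I ((\<lambda>v. {v}) ` V)) \<le> card V"
  using card_mono[of "(\<lambda>v. {v}) ` V" "light I ((\<lambda>v. {v}) ` V)"] fin
  by (auto simp: light_def card_image)

lemma card_budget_min_cuts_le:
  assumes w: "\<And>i v. i \<in> {1..t} \<Longrightarrow> v \<in> V \<Longrightarrow> 0 \<le> w i v"
  shows "card {F. budget_min_cut V E c t w b F} \<le> card V ^ 2"
proof (cases "V = {}")
  case True
  then have "{F. budget_min_cut V E c t w b F} = {}" by (auto simp: budget_min_cut_def)
  then show ?thesis by simp
next
  case False
  then have n: "1 \<le> card V" using fin by (simp add: Suc_le_eq card_gt_0_iff)
  let ?I = "feasible V t w b" and ?P = "(\<lambda>v. {v}) ` V"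
  let ?m = "card (light ?I ?P)"
  have "{F. budget_min_cut V E c t w b F}
      \<subseteq> insert (cut V E (\<Union>(light ?I ?P))) (split_light_mincuts ?I ?P)"
    by (auto simp: mincut_budget split_light_mincuts_def saturated_singletons)
  then have "card {F. budget_min_cut V E c t w b F}
      \<le> card (insert (cut V E (\<Union>(light ?I ?P))) (split_light_mincuts ?I ?P))"
    using finite_split_light_mincuts by (intro card_mono) auto
  also have "\<dots> \<le> Suc (card (split_light_mincuts ?I ?P))"
    using finite_split_light_mincuts by (simp add: card_insert_if)
  also have "\<dots> \<le> Suc (?m * (?m - 1))"
    using card_split_light_mincuts[OF partition_on_singletons hereditary_feasible[OF fin w]] by simp
  also have "\<dots> \<le> Suc (card V * (card V - 1))"
    using card_light_singletons[of ?I] by (intro Suc_le_mono[THEN iffD2] mult_le_mono) auto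
  \<comment> \<open>The \<open>Suc\<close> is the cut around the union of the light blocks;
    \<open>1 + n * (n - 1)\<close> is at most \<open>n ^ 2\<close> since \<open>n\<close> is
    positive.\<close>
  also have "\<dots> \<le> card V ^ 2"
    using n by (cases "card V") (auto simp: power2_eq_square)
  finally show ?thesis .
qed

text \<open>Each nonempty cut weighs at least \<open>1 / (2 * 2 ^ r * n ^ 2)\<close> in a total of
  at most \<open>r * n ^ t\<close>, which gives the constant 2. The empty cut is added separately
  and raises it to 3.\<close>

lemma card_multiobjective_min_cuts_le:
  assumes w: "\<And>i v. i \<in> {1..t} \<Longrightarrow> v \<in> V \<Longrightarrow> 0 \<le> w i v"
    and r: "\<And>e. e \<in> E \<Longrightarrow> card e \<le> r" "1 \<le> r" and V: "V \<noteq> {}"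
  shows "real (card {F. multiobjective_min_cut V E c t w F})
    \<le> 3 * (real r * 2 ^ r * real (card V) ^ (t + 2))"
proof -
  let ?n = "real (card V)" and ?M = "{F. multiobjective_min_cut V E c t w F}"
  have n: "1 \<le> ?n" using V fin by (simp add: Suc_le_eq card_gt_0_iff)
  have "1 * 1 \<le> real r * 2 ^ r" using r(2) by (intro mult_mono) auto
  then have rn: "1 * 1 \<le> real r * 2 ^ r * ?n ^ k" for k
    using n by (intro mult_mono) auto
  show ?thesis
  proof (cases "t = 0")
    case True
    \<comment> \<open>Without weight functions all budgets impose the same empty condition, so the
      zero budget represents them all.\<close>
    then have "?M \<subseteq> {F. budget_min_cut V E c t w (\<lambda>_. 0) F}"
      by (auto simp: multiobjective_min_cut_def budget_min_cut_def feasible_def)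
    moreover have "finite {F. budget_min_cut V E c t w (\<lambda>_. 0) F}"
      by (rule finite_subset[of _ "Pow E"]) (use finite_E in \<open>auto simp: budget_min_cut_def cut_def\<close>)
    ultimately have "card ?M \<le> card V ^ 2"
      using card_budget_min_cuts_le[OF w] card_mono le_trans by meson
    then have "real (card ?M) \<le> 1 * ?n ^ 2"
      by (metis mult_1 of_nat_le_iff of_nat_power)
    also have "\<dots> \<le> (3 * (real r * 2 ^ r)) * ?n ^ 2"
      using rn[of 0] by (intro mult_right_mono) auto
    finally show ?thesis using True by (simp add: mult.assoc power2_eq_square)
  next
    case False
    let ?S = "?M - {{}}" and ?P = "(\<lambda>v. {v}) ` V"
    have finM: "finite ?M"
      by (rule finite_subset[of _ "Pow E"])
        (use finite_E in \<open>auto simp: multiobjective_min_cut_def budget_min_cut_def cut_def\<close>)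
    \<comment> \<open>The pair consists of a side of \<open>F\<close> and a budget for which that
      side is minimum.\<close>
    have "\<forall>F\<in>?S. \<exists>p. F = cut V E (fst p) \<and> mincut (feasible V t w (snd p)) (fst p)"
      by (auto simp: multiobjective_min_cut_def mincut_budget)
    then have "\<exists>p. \<forall>F\<in>?S. F = cut V E (fst (p F)) \<and> mincut (feasible V t w (snd (p F))) (fst (p F))"
      by (rule bchoice)
    then obtain p where p: "\<forall>F\<in>?S. F = cut V E (fst (p F)) \<and> mincut (feasible V t w (snd (p F))) (fst (p F))"
      by (rule exE)
    let ?m = "\<lambda>F. card (light (feasible V t w (snd (p F))) ?P)"
    have "(\<Sum>F\<in>?S. 1 / guess_bound r (?m F)) \<le> real r * real (card ?P) ^ t"
    proof (rule sum_inverse_guess_bound_le[OF _ w r(1) partition_on_singletons])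
      show "F \<noteq> {} \<and> F = cut V E (fst (p F)) \<and> mincut (feasible V t w (snd (p F))) (fst (p F))
          \<and> saturated ?P (fst (p F))" if "F \<in> ?S" for F
        using bspec[OF p that] that saturated_singletons by blast
    qed (use False finM in auto)
    also have "card ?P = card V" by (simp add: card_image)
    finally have total: "(\<Sum>F\<in>?S. 1 / guess_bound r (?m F)) \<le> real r * ?n ^ t" .
    have "1 / (2 * 2 ^ r * ?n ^ 2) \<le> 1 / guess_bound r (?m F)" for F
      using guess_bound_le[OF r(2) _ card_light_singletons] V fin guess_bound_pos
      by (intro divide_left_mono mult_pos_pos) (auto simp: Suc_le_eq card_gt_0_iff)
    then have "real (card ?S) * (1 / (2 * 2 ^ r * ?n ^ 2)) \<le> (\<Sum>F\<in>?S. 1 / guess_bound r (?m F))"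
      by (rule sum_bounded_below)
    then have "real (card ?S) / (2 * 2 ^ r * ?n ^ 2) \<le> real r * ?n ^ t" using total by simp
    then have "real (card ?S) \<le> real r * ?n ^ t * (2 * 2 ^ r * ?n ^ 2)"
      using n by (simp only: divide_le_eq) auto
    also have "\<dots> = 2 * (real r * 2 ^ r * ?n ^ (t + 2))"
      by (simp add: power_add power2_eq_square)
    finally have "real (card ?S) + 1 \<le> 3 * (real r * 2 ^ r * ?n ^ (t + 2))"
      using rn[of "t + 2"] by linarith
    moreover have "card ?M \<le> Suc (card ?S)"
      using diff_card_le_card_Diff[of "{{}}" ?M] by simp
    ultimately show ?thesis by linarith
  qed
qed

end

theorem theorem2:
  shows "(\<exists>C::real. \<forall>(V::'v set) E c t w n r.
            hypergraph V E \<and> card V = n \<and> cost_weight_functions V E c t w \<and>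
            E \<noteq> {} \<and> rank E = r \<longrightarrow>
            real (card {F. multiobjective_min_cut V E c t w F})
              \<le> C * (real r * 2 ^ r * real n ^ (t + 2)))
       \<and> (\<exists>C::real. \<forall>(V::'v set) E c t w n b.
            hypergraph V E \<and> card V = n \<and> cost_weight_functions V E c t w \<and>
            (\<forall>i\<in>{1..t}. 0 \<le> b i) \<longrightarrow>
            real (card {F. budget_min_cut V E c t w b F}) \<le> C * real n ^ 2)"
proof (intro conjI exI allI impI)
  fix V :: "'v set" and E c t w n r
  assume *: "hypergraph V E \<and> card V = n \<and> cost_weight_functions V E c t w \<and> E \<noteq> {} \<and> rank E = r"
  interpret weighted_hypergraph V E c
    using * by unfold_locales (auto simp: hypergraph_def cost_weight_functions_def)
  obtain e where e: "e \<in> E" using * by auto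
  then have ne: "e \<noteq> {}" "e \<subseteq> V" using * by (auto simp: hypergraph_def)
  have r: "card e \<le> r" if "e \<in> E" for e
    using * that finite_E by (auto simp: rank_def)
  \<comment> \<open>Hyperedges are nonempty, so the rank is at least 1, as
    \<open>guess_bound_le\<close> requires.\<close>
  have "1 \<le> card e" using ne finite_subset[OF ne(2) fin] by (simp add: Suc_le_eq card_gt_0_iff)
  then have "1 \<le> r" using r[OF e] by linarith
  then show "real (card {F. multiobjective_min_cut V E c t w F})
      \<le> 3 * (real r * 2 ^ r * real n ^ (t + 2))"
    using card_multiobjective_min_cuts_le[of t w r] r ne * by (auto simp: cost_weight_functions_def)
next
  fix V :: "'v set" and E c t w n and b :: "nat \<Rightarrow> real"
  assume *: "hypergraph V E \<and> card V = n \<and> cost_weight_functions V E c t w \<and> (\<forall>i\<in>{1..t}. 0 \<le> b i)"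
  interpret weighted_hypergraph V E c
    using * by unfold_locales (auto simp: hypergraph_def cost_weight_functions_def)
  have "card {F. budget_min_cut V E c t w b F} \<le> card V ^ 2"
    using * by (intro card_budget_min_cuts_le) (auto simp: cost_weight_functions_def)
  then show "real (card {F. budget_min_cut V E c t w b F}) \<le> 1 * real n ^ 2"
    using * by (metis mult_1 of_nat_le_iff of_nat_power)
qed

end
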